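(* Let $\alpha$ be a nonzero complex number, $\lambda$ a complex number, and $n,k\ge 0$ integers. Then $$\sum_{j=0}^{k}\alpha^{k-j}S_{1}(k,j)\lambda^{j}j^{n}=\sum_{\ell=0}^{k}(-1)_{k-\ell,\alpha}\,\ell!\binom{k}{\ell}\,y_{1,\alpha}^{*}(n,\ell;\lambda).$$
   Context: For an element $x$ of a commutative $\mathbb{C}$-algebra (e.g. a number or a formal power series in $t$), the degenerate falling factorial is $(x)_{0,\alpha}=1$ and $(x)_{n,\alpha}=x(x-\alpha)(x-2\alpha)\cdots(x-(n-1)\alpha)$ for $n\ge 1$. The falling factorial is $(x)_0=1$, $(x)_n=x(x-1)\cdots(x-n+1)$ for $n\ge1$. The (signed) Stirling numbers of the first kind $S_1(n,k)$ are defined by $(x)_n=\sum_{k=0}^{n}S_1(n,k)x^k$. The new type degenerate Simsek numbers $y_{1,\alpha}^{*}(n,k;\lambda)$ are defined by the generating function $$\frac{(\lambda e^t+1)_{k,\alpha}}{k!}=\sum_{n=0}^{\infty}y_{1,\alpha}^{*}(n,k;\lambda)\frac{t^n}{n!}.$$ Convention: $0^0=1$. *)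

theory Defs
  imports Complex_Main "HOL-Computational_Algebra.Computational_Algebra"
begin

(* (x)_{n,alpha}.  The step alpha lives in the same ring as x: a complex number alpha acts on the
   algebra of formal power series as the constant series fps_const alpha. *)
definition deg_ffact :: "'a :: comm_ring_1 \<Rightarrow> nat \<Rightarrow> 'a \<Rightarrow> 'a" where
  "deg_ffact x n \<alpha> = (\<Prod>i<n. x - of_nat i * \<alpha>)"

definition ffact :: "'a :: comm_ring_1 \<Rightarrow> nat \<Rightarrow> 'a" where
  "ffact x n = (\<Prod>i<n. x - of_nat i)"

(* Signed, unlike the library's stirling.  The defining expansion (x)_n = sum_k S1(n,k) x^k is read
   as an identity of polynomials in the indeterminate x = [:0, 1:]. *)
definition S1 :: "nat \<Rightarrow> nat \<Rightarrow> int" where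
  "S1 n k = coeff (ffact [:0, 1:] n) k"

definition simsek_gf :: "complex \<Rightarrow> nat \<Rightarrow> complex \<Rightarrow> complex fps" where
  "simsek_gf \<alpha> k lam =
     deg_ffact (fps_const lam * fps_exp 1 + 1) k (fps_const \<alpha>) / fps_const (fact k)"

(* simsek_y alpha n k lam is y*_{1,alpha}(n, k; lam). *)
definition simsek_y :: "complex \<Rightarrow> nat \<Rightarrow> nat \<Rightarrow> complex \<Rightarrow> complex" where
  "simsek_y \<alpha> n k lam = fact n * fps_nth (simsek_gf \<alpha> k lam) n"

lemma degree_ffact_poly: "degree (ffact [:0, 1 :: int:] n) \<le> n"
proof (induction n)
  case (Suc n)
  have "degree ([:0, 1 :: int:] - of_nat n) \<le> 1"
    by (simp add: of_nat_poly)
  with Suc have "degree (ffact [:0, 1 :: int:] n * ([:0, 1:] - of_nat n)) \<le> n + 1"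
    by (meson add_mono degree_mult_le order_trans)
  then show ?case by (simp add: ffact_def)
qed (simp add: ffact_def)

lemma ffact_eq_sum_S1:
  fixes x :: "'a :: comm_ring_1"
  shows "ffact x n = (\<Sum>k\<le>n. of_int (S1 n k) * x ^ k)"
proof -
  let ?p = "ffact [:0, 1 :: int:] n"
  have lin: "map_poly of_int ([:0, 1 :: int:] - of_nat i) = [:- of_nat i, 1 :: 'a:]" for i
    by (simp add: of_nat_poly map_poly_pCons)
  have "poly (map_poly of_int ?p) x = ffact x n"
  proof (induction n)
    case (Suc n)
    have mult: "map_poly (of_int :: int \<Rightarrow> 'a) (p * q) = map_poly of_int p * map_poly of_int q"
      for p q by (intro poly_eqI) (simp add: coeff_map_poly coeff_mult)
    have "map_poly (of_int :: int \<Rightarrow> 'a) (ffact [:0, 1:] (Suc n)) =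
        map_poly of_int (ffact [:0, 1:] n) * [:- of_nat n, 1:]"
      unfolding ffact_def prod.lessThan_Suc mult lin ..
    then have "poly (map_poly of_int (ffact [:0, 1:] (Suc n))) x = ffact x n * (x - of_nat n)"
      using Suc by (simp only: poly_mult) simp
    then show ?case by (simp add: ffact_def)
  qed (simp add: ffact_def)
  moreover have "degree (map_poly (of_int :: int \<Rightarrow> 'a) ?p) \<le> n"
    by (rule order_trans[OF map_poly_degree_leq degree_ffact_poly])
  then have "poly (map_poly of_int ?p) x = (\<Sum>k\<le>n. coeff (map_poly of_int ?p) k * x ^ k)"
    unfolding poly_altdef by (intro sum.mono_neutral_left) (auto simp: coeff_eq_0)
  ultimately show ?thesis
    by (simp add: S1_def coeff_map_poly)
qed

lemma simsek_y_gf: "simsek_gf \<alpha> k lam = Abs_fps (\<lambda>n. simsek_y \<alpha> n k lam / fact n)"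
  by (rule fps_ext) (simp add: simsek_y_def)

end

(* With X = lam * exp t, expand the degenerate falling factorial of X = (X + 1) + (-1) in two ways:
   in powers of X with Stirling coefficients, and by the Vandermonde identity.  Comparing the
   coefficients of t^n gives the claim, since X^j = lam^j * exp (j t). *)

theory Submission
  imports Defs
begin

lemma deg_ffact_0 [simp]: "deg_ffact x 0 a = 1"
  by (simp add: deg_ffact_def)

lemma deg_ffact_Suc: "deg_ffact x (Suc n) a = deg_ffact x n a * (x - of_nat n * a)"
  by (simp add: deg_ffact_def)

text \<open>Holds because \<open>fps_const\<close> is a ring homomorphism; it turns factors built
  from the constant series -1 back into scalars, which pass through coefficient extraction.\<close>

lemma fps_const_deg_ffact:
  "fps_const (deg_ffact x n a) = deg_ffact (fps_const x) n (fps_const a)"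
proof (induction n)
  case 0
  show ?case by simp
next
  case (Suc n)
  show ?case by (simp add: deg_ffact_Suc flip: Suc.IH fps_of_nat)
qed

text \<open>Vandermonde by induction on \<open>n\<close>: in the summand for \<open>l\<close>, the
  new factor splits as (x - l a) + (y - (n - l) a), and each part lengthens one of the two products
  by one factor.\<close>

lemma deg_ffact_add:
  "deg_ffact (x + y) n a =
     (\<Sum>l\<le>n. of_nat (n choose l) * deg_ffact x l a * deg_ffact y (n - l) a)"
proof (induction n)
  case 0
  show ?case by simp
next
  case (Suc n)
  let ?X = "\<lambda>l. deg_ffact x l a" and ?Y = "\<lambda>l. deg_ffact y l a"
  let ?C = "\<lambda>l. of_nat (n choose l) :: 'a"
  have split: "?C l * ?X l * ?Y (n - l) * (x + y - of_nat n * a) =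
      ?C l * ?X (Suc l) * ?Y (n - l) + ?C l * ?X l * ?Y (Suc n - l)" if "l \<le> n" for l
  proof -
    have "x + y - of_nat n * a = (x - of_nat l * a) + (y - of_nat (n - l) * a)"
      using that by (simp add: of_nat_diff algebra_simps)
    then show ?thesis
      using that by (simp add: deg_ffact_Suc Suc_diff_le algebra_simps)
  qed
  \<comment> \<open>Adding the term l = n + 1 is free since its binomial coefficient vanishes; the
    term l = 0 is then peeled off to align the indices with the other sum.\<close>
  have shift: "(\<Sum>l\<le>n. ?C l * ?X l * ?Y (Suc n - l)) =
      ?Y (Suc n) + (\<Sum>l\<le>n. ?C (Suc l) * ?X (Suc l) * ?Y (n - l))"
  proof -
    have "(\<Sum>l\<le>n. ?C l * ?X l * ?Y (Suc n - l)) = (\<Sum>l\<le>Suc n. ?C l * ?X l * ?Y (Suc n - l))"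
      by (simp add: binomial_eq_0)
    also have "\<dots> = ?Y (Suc n) + (\<Sum>l\<le>n. ?C (Suc l) * ?X (Suc l) * ?Y (n - l))"
      by (subst sum.atMost_Suc_shift) simp
    finally show ?thesis .
  qed
  have "deg_ffact (x + y) (Suc n) a =
      (\<Sum>l\<le>n. ?C l * ?X l * ?Y (n - l) * (x + y - of_nat n * a))"
    by (simp add: deg_ffact_Suc Suc.IH sum_distrib_right)
  also have "\<dots> = (\<Sum>l\<le>n. ?C l * ?X (Suc l) * ?Y (n - l)) +
      (\<Sum>l\<le>n. ?C l * ?X l * ?Y (Suc n - l))"
    unfolding sum.distrib[symmetric] by (intro sum.cong refl split) simp
  \<comment> \<open>Pascal's rule merges the two aligned sums.\<close>
  also have "\<dots> = ?Y (Suc n) +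
      (\<Sum>l\<le>n. of_nat (Suc n choose Suc l) * ?X (Suc l) * ?Y (n - l))"
    unfolding shift by (simp add: distrib_right sum.distrib add_ac)
  also have "\<dots> = (\<Sum>l\<le>Suc n. of_nat (Suc n choose l) * ?X l * ?Y (Suc n - l))"
    by (subst sum.atMost_Suc_shift) simp
  finally show ?case .
qed

text \<open>Since x - i a = a (b x - i), this is a^n times the ordinary falling factorial at b x. An
  explicit inverse \<open>b\<close> replaces division because the lemma is applied to formal power
  series, which do not form a field.\<close>

lemma deg_ffact_eq_sum_S1:
  fixes x a b :: "'a :: comm_ring_1"
  assumes "a * b = 1"
  shows "deg_ffact x n a = (\<Sum>j\<le>n. a ^ (n - j) * of_int (S1 n j) * x ^ j)"
proof -
  have "deg_ffact x n a = (\<Prod>i<n. a * (b * x - of_nat i))"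
    unfolding deg_ffact_def using assms
    by (intro prod.cong refl) (simp add: right_diff_distrib mult_ac flip: mult.assoc)
  also have "\<dots> = a ^ n * (\<Sum>j\<le>n. of_int (S1 n j) * (b * x) ^ j)"
    by (simp add: prod.distrib flip: ffact_def ffact_eq_sum_S1)
  also have "\<dots> = (\<Sum>j\<le>n. a ^ (n - j) * of_int (S1 n j) * x ^ j)"
    unfolding sum_distrib_left
  proof (intro sum.cong refl)
    fix j assume "j \<in> {..n}"
    then have "a ^ n = a ^ (n - j) * a ^ j"
      by (simp flip: power_add)
    then have "a ^ n * (of_int (S1 n j) * (b * x) ^ j) =
        a ^ (n - j) * of_int (S1 n j) * x ^ j * (a * b) ^ j"
      by (simp add: power_mult_distrib mult_ac)
    then show "a ^ n * (of_int (S1 n j) * (b * x) ^ j) = a ^ (n - j) * of_int (S1 n j) * x ^ j"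
      by (simp add: assms)
  qed
  finally show ?thesis .
qed

lemma deg_ffact_eq_simsek_gf:
  "deg_ffact (fps_const lam * fps_exp 1 + 1) l (fps_const \<alpha>) =
     fps_const (fact l) * simsek_gf \<alpha> l lam"
  by (simp add: simsek_gf_def fps_divide_unit fps_const_inverse mult.left_commute)

theorem theorem2p1:
  fixes \<alpha> lam :: complex and n k :: nat
  assumes "\<alpha> \<noteq> 0"
  shows "(\<Sum>j=0..k. \<alpha> ^ (k - j) * of_int (S1 k j) * lam ^ j * of_nat j ^ n) =
         (\<Sum>l=0..k. deg_ffact (-1) (k - l) \<alpha> * fact l * of_nat (k choose l) * simsek_y \<alpha> n l lam)"
proof -
  let ?X = "fps_const lam * fps_exp 1 :: complex fps"
  let ?D = "deg_ffact ?X k (fps_const \<alpha>)"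
  have inv: "fps_const \<alpha> * fps_const (inverse \<alpha>) = 1"
    using assms by simp
  \<comment> \<open>The j-th power of exp(t) is exp(j t), whose n-th coefficient is j^n /
    n!.\<close>
  have "?D = (\<Sum>j\<le>k. fps_const (\<alpha> ^ (k - j) * of_int (S1 k j) * lam ^ j) * fps_exp (of_nat j))"
    unfolding deg_ffact_eq_sum_S1[OF inv]
    by (simp add: power_mult_distrib fps_exp_power_mult fps_const_power mult.assoc
        flip: fps_of_int fps_const_mult)
  then have stirling: "fact n * fps_nth ?D n =
      (\<Sum>j=0..k. \<alpha> ^ (k - j) * of_int (S1 k j) * lam ^ j * of_nat j ^ n)"
    by (simp add: fps_sum_nth sum_distrib_left atMost_atLeast0)
  \<comment> \<open>The shift by 1 produces the argument X + 1 of the generating function; -1 is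
    written as a constant series so that its falling factorials become scalars.\<close>
  have "?D = deg_ffact ((?X + 1) + fps_const (-1)) k (fps_const \<alpha>)"
    by (simp flip: fps_const_neg)
  also have "\<dots> = (\<Sum>l\<le>k. fps_const (deg_ffact (-1) (k - l) \<alpha> * fact l * of_nat (k choose l)) *
      simsek_gf \<alpha> l lam)"
    unfolding deg_ffact_add[of "?X + 1"] deg_ffact_eq_simsek_gf fps_const_deg_ffact[symmetric]
    by (simp add: mult_ac flip: fps_of_nat fps_const_mult)
  finally have "fact n * fps_nth ?D n =
      (\<Sum>l=0..k. deg_ffact (-1) (k - l) \<alpha> * fact l * of_nat (k choose l) * simsek_y \<alpha> n l lam)"
    by (simp add: fps_sum_nth sum_distrib_left atMost_atLeast0 simsek_y_def mult_ac)
  then show ?thesis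
    using stirling by simp
qed

end
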